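(* Let $n$ be divisible by $3$ and large enough that Waiter has a winning strategy in the unbiased Waiter-Client triangle-factor game on the edges of $K_n$. Then $$\tau_{WC}(\mathcal{F}_{n,K_3\text{-fac}},1) \geq \tfrac{7}{6}n.$$
   Context: The unbiased Waiter-Client triangle-factor game on $K_n$ ($n$ divisible by $3$): initially all edges of $K_n$ are unclaimed. In each round Waiter picks two yet unclaimed edges and offers them to Client; Client chooses one of them to be added to Client's graph, and the other is added to Waiter's graph. Waiter wins if at some point Client's graph contains a $K_3$-factor (a collection of $n/3$ vertex-disjoint triangles covering all vertices); otherwise Client wins. $\tau_{WC}(\mathcal{F}_{n,K_3\text{-fac}},1)$ denotes the number of rounds the game lasts when Waiter tries to win as fast as possible, Client tries to delay her as long as possible, and both play optimally. *)

theory Defs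
  imports "HOL-Library.Ramsey" "HOL-Library.Disjoint_Sets" "HOL-Library.Extended_Real"
begin

section \<open>Unbiased Waiter-Client games on a board \<open>X\<close> with winning sets \<open>F\<close>\<close>

text \<open>A history lists the rounds played so far; each round is recorded as the offered pair of
  elements together with the element that Client took.\<close>

type_synonym 'a history = "('a set \<times> 'a) list"
type_synonym 'a waiter_strategy = "'a history \<Rightarrow> 'a set"
type_synonym 'a client_strategy = "'a history \<Rightarrow> 'a set \<Rightarrow> 'a"

definition unclaimed :: "'a set \<Rightarrow> 'a history \<Rightarrow> 'a set" where
  "unclaimed X h = X - \<Union> (fst ` set h)"

definition client_elements :: "'a history \<Rightarrow> 'a set" where
  "client_elements h = snd ` set h"

definition waiter_strategies :: "'a set \<Rightarrow> 'a waiter_strategy set" where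
  "waiter_strategies X =
     {\<sigma>. \<forall>h. 2 \<le> card (unclaimed X h) \<longrightarrow> \<sigma> h \<subseteq> unclaimed X h \<and> card (\<sigma> h) = 2}"

definition client_strategies :: "'a client_strategy set" where
  "client_strategies = {\<rho>. \<forall>h P. card P = 2 \<longrightarrow> \<rho> h P \<in> P}"

text \<open>No further round is possible once fewer than two elements are unclaimed; from then on the
  history stays constant.\<close>

fun play :: "'a set \<Rightarrow> 'a waiter_strategy \<Rightarrow> 'a client_strategy \<Rightarrow> nat \<Rightarrow> 'a history" where
  "play X \<sigma> \<rho> 0 = []"
| "play X \<sigma> \<rho> (Suc k) =
     (let h = play X \<sigma> \<rho> k in
      if 2 \<le> card (unclaimed X h) then h @ [(\<sigma> h, \<rho> h (\<sigma> h))] else h)"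

definition won_after ::
  "'a set \<Rightarrow> 'a set set \<Rightarrow> 'a waiter_strategy \<Rightarrow> 'a client_strategy \<Rightarrow> nat \<Rightarrow> bool" where
  "won_after X F \<sigma> \<rho> k \<longleftrightarrow> (\<exists>A\<in>F. A \<subseteq> client_elements (play X \<sigma> \<rho> k))"

definition waiter_has_winning_strategy :: "'a set \<Rightarrow> 'a set set \<Rightarrow> bool" where
  "waiter_has_winning_strategy X F \<longleftrightarrow>
     (\<exists>\<sigma>\<in>waiter_strategies X. \<forall>\<rho>\<in>client_strategies. \<exists>k. won_after X F \<sigma> \<rho> k)"

text \<open>The number of rounds until Waiter has won; it is \<open>\<infinity>\<close> (the infimum of the empty set) for
  plays that Client wins.\<close>

definition rounds ::
  "'a set \<Rightarrow> 'a set set \<Rightarrow> 'a waiter_strategy \<Rightarrow> 'a client_strategy \<Rightarrow> enat" where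
  "rounds X F \<sigma> \<rho> = (INF k\<in>{k. won_after X F \<sigma> \<rho> k}. enat k)"

definition tau_WC :: "'a set \<Rightarrow> 'a set set \<Rightarrow> enat" where
  "tau_WC X F = (INF \<sigma>\<in>waiter_strategies X. SUP \<rho>\<in>client_strategies. rounds X F \<sigma> \<rho>)"

section \<open>The triangle-factor game on \<open>K\<^sub>n\<close>\<close>

text \<open>Edges are two-element vertex sets, so \<open>nsets V 2\<close> is the edge set of the complete graph
  on \<open>V\<close>.\<close>

definition K_edges :: "nat \<Rightarrow> nat set set" where
  "K_edges n = nsets {..<n} 2"

text \<open>A triangle factor is given by a partition \<open>P\<close> of the vertices into triples; its edge set
  consists of all pairs inside the triples.\<close>

definition triangle_factors :: "nat \<Rightarrow> nat set set set" where
  "triangle_factors n =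
     {(\<Union>T\<in>P. nsets T 2) | P. partition_on {..<n} P \<and> (\<forall>T\<in>P. card T = 3)}"

end

theory Submission
  imports Defs
begin

text \<open>
  Client keeps a set \<open>R\<close> of registered edges among those that went to Waiter. A component of his graph
  on \<open>3k\<close> vertices is bad if it has a triangle factor, has only \<open>4k - 1\<close> edges (so \<open>k\<close> triangles
  joined in a tree-like way by \<open>k - 1\<close> bridges) and contains exactly \<open>k - 1\<close> registered edges; an
  isolated triangle is the case \<open>k = 1\<close>. Client avoids creating a bad component; if both offered
  edges would do so, he takes either of them and registers the other. Losing that edge spoils its
  component, and inductively every triangle factor wastes at least as many edges of a component as
  there are registered edges in it. Bad components are created only together with a registration, so
  there are at most \<open>|R|\<close> of them.

  In the end, let a component have \<open>k\<close> factor triangles, \<open>w\<close> wasted edges and \<open>r\<close> registered edges.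
  Then \<open>w \<ge> k - 1\<close> and \<open>w \<ge> r\<close>, whence \<open>2w - k \<ge> r\<close>, except that \<open>2w - k = r - 1\<close> if it is bad.
  Summing over the components, at least \<open>n/6\<close> edges are wasted in addition to the \<open>n\<close> edges of the
  factor.
\<close>

section \<open>Closed sets, tilings and Client's invariant\<close>

definition edge_closed :: "'a set set \<Rightarrow> 'a set \<Rightarrow> bool" where
  "edge_closed E V \<longleftrightarrow> (\<forall>e\<in>E. e \<inter> V \<noteq> {} \<longrightarrow> e \<subseteq> V)"

text \<open>Connectivity is encoded without paths: a component is a minimal nonempty vertex set that
  no edge leaves. Arguments about connectedness thus become Boolean operations on closed
  sets.\<close>

definition component :: "'a set \<Rightarrow> 'a set set \<Rightarrow> 'a set \<Rightarrow> bool" where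
  "component N E V \<longleftrightarrow> V \<subseteq> N \<and> V \<noteq> {} \<and> edge_closed E V \<and>
     (\<forall>A\<subseteq>V. edge_closed E A \<longrightarrow> A = {} \<or> A = V)"

definition inside :: "'a set set \<Rightarrow> 'a set \<Rightarrow> 'a set set" where
  "inside E V = {e \<in> E. e \<subseteq> V}"

definition pairs :: "'a set set \<Rightarrow> 'a set set" where
  "pairs P = (\<Union>T\<in>P. nsets T 2)"

definition packing :: "'a set \<Rightarrow> 'a set set \<Rightarrow> bool" where
  "packing N P \<longleftrightarrow> disjoint P \<and> \<Union>P \<subseteq> N \<and> (\<forall>T\<in>P. card T = 3)"

definition triples :: "'a set \<Rightarrow> 'a set set \<Rightarrow> bool" where
  "triples V P \<longleftrightarrow> partition_on V P \<and> (\<forall>T\<in>P. card T = 3)"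

definition waste :: "'a set set \<Rightarrow> 'a set \<Rightarrow> 'a set set \<Rightarrow> nat" where
  "waste E V P = card (inside E V - pairs P)"

text \<open>With \<open>k = card P\<close>, the two equations read \<open>4k - 1\<close> edges and
  \<open>k - 1\<close> registered edges; they are written additively to avoid truncated
  subtraction.\<close>

definition bad :: "'a set \<Rightarrow> 'a set set \<Rightarrow> 'a set set \<Rightarrow> 'a set \<Rightarrow> bool" where
  "bad N E R V \<longleftrightarrow> component N E V \<and>
     (\<exists>P. triples V P \<and> pairs P \<subseteq> E \<and> card (inside E V) + 1 = 4 * card P \<and>
          card (inside R V) + 1 = card P)"

definition bad_move :: "'a set \<Rightarrow> 'a set set \<Rightarrow> 'a set set \<Rightarrow> 'a set \<Rightarrow> bool" where
  "bad_move N E R e \<longleftrightarrow> (\<exists>V. bad N (insert e E) R V \<and> e \<subseteq> V)"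

text \<open>The fourth clause keeps registered edges from joining different components, so they can
  be counted componentwise. The waste bound ranges over all packings avoiding \<open>R\<close>, not
  only over triangles already in \<open>E\<close>. For a fixed packing, waste can only grow with
  \<open>E\<close>, so the bound survives until a real factor appears. It is required for every
  closed set, which lets it be applied to what remains after a component is cut off.\<close>

definition delay_inv :: "'a set \<Rightarrow> 'a set set \<Rightarrow> 'a set set \<Rightarrow> bool" where
  "delay_inv N E R \<longleftrightarrow> E \<subseteq> nsets N 2 \<and> R \<subseteq> nsets N 2 \<and> E \<inter> R = {} \<and>
     (\<forall>V f. edge_closed E V \<longrightarrow> f \<in> R \<longrightarrow> f \<inter> V \<noteq> {} \<longrightarrow> f \<subseteq> V) \<and>
     (\<forall>V P. edge_closed E V \<longrightarrow> packing N P \<longrightarrow> pairs P \<inter> R = {} \<longrightarrow>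
        card (inside R V) \<le> waste E V P) \<and>
     card {V. bad N E R V} \<le> card R"

section \<open>Edges, closed sets and triangle tilings\<close>

lemma nsets_2_iff: "e \<in> nsets T 2 \<longleftrightarrow> e \<subseteq> T \<and> card e = 2"
  unfolding nsets_def by (auto intro: card_ge_0_finite)

lemma card_nsets_triple: "card T = 3 \<Longrightarrow> card (nsets T 2) = 3"
  using card_nsets[of T 2] by (simp add: numeral_eq_Suc)

lemma in_pairs_iff: "e \<in> pairs P \<longleftrightarrow> (\<exists>T\<in>P. e \<subseteq> T \<and> card e = 2)"
  by (auto simp: pairs_def nsets_2_iff)

lemma finite_pairs_graph:
  assumes "finite N" "E \<subseteq> nsets N 2" shows "finite E"
  using assms finite_imp_finite_nsets finite_subset by blast

lemma inside_subset: "inside E V \<subseteq> E"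
  by (auto simp: inside_def)

lemma edge_closed_mono: "edge_closed E' V \<Longrightarrow> E \<subseteq> E' \<Longrightarrow> edge_closed E V"
  by (auto simp: edge_closed_def)

lemma edge_closedD: "edge_closed E V \<Longrightarrow> e \<in> E \<Longrightarrow> v \<in> e \<Longrightarrow> v \<in> V \<Longrightarrow> e \<subseteq> V"
  by (auto simp: edge_closed_def)

lemma edge_closedI: "(\<And>e v. e \<in> E \<Longrightarrow> v \<in> e \<Longrightarrow> v \<in> V \<Longrightarrow> e \<subseteq> V) \<Longrightarrow> edge_closed E V"
  by (auto simp: edge_closed_def)

lemma edge_closed_Int: "edge_closed E A \<Longrightarrow> edge_closed E B \<Longrightarrow> edge_closed E (A \<inter> B)"
  by (intro edge_closedI) (auto dest: edge_closedD)

lemma edge_closed_Diff: "edge_closed E A \<Longrightarrow> edge_closed E B \<Longrightarrow> edge_closed E (A - B)"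
  by (intro edge_closedI) (auto dest: edge_closedD)

lemma
  assumes "component N E V"
  shows component_subset: "V \<subseteq> N"
    and component_nonempty: "V \<noteq> {}"
    and component_closed: "edge_closed E V"
    and component_minimal: "A \<subseteq> V \<Longrightarrow> edge_closed E A \<Longrightarrow> A = {} \<or> A = V"
  using assms by (auto simp: component_def)

lemma componentI:
  assumes "V \<subseteq> N" "V \<noteq> {}" "edge_closed E V"
    "\<And>A. A \<subseteq> V \<Longrightarrow> edge_closed E A \<Longrightarrow> A \<noteq> {} \<Longrightarrow> A = V"
  shows "component N E V"
  using assms by (auto simp: component_def)

lemma triples_packing: "triples V P \<Longrightarrow> V \<subseteq> N \<Longrightarrow> packing N P"
  by (auto simp: triples_def packing_def partition_on_def)

lemma triples_card:
  assumes "triples V P" "finite V"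
  shows "finite P" "card V = 3 * card P"
proof -
  show "finite P"
    using assms by (auto simp: triples_def intro: finite_elements)
  have "card V = (\<Sum>T\<in>P. card T)"
    using assms product_partition[of V P] by (auto simp: triples_def partition_on_def intro: finite_subset)
  thus "card V = 3 * card P"
    using assms by (simp add: triples_def)
qed

lemma card_pairs_triples:
  assumes "packing N P" "finite P"
  shows "card (pairs P) = 3 * card P"
proof -
  have "card (pairs P) = (\<Sum>T\<in>P. card (nsets T 2))"
    unfolding pairs_def
  proof (rule card_UN_disjoint)
    show "finite P" by fact
    show "\<forall>T\<in>P. finite (nsets T 2)"
      using assms by (auto simp: packing_def intro!: finite_imp_finite_nsets card_ge_0_finite)
    show "\<forall>S\<in>P. \<forall>T\<in>P. S \<noteq> T \<longrightarrow> nsets S 2 \<inter> nsets T 2 = {}"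
    proof (intro ballI impI)
      fix S T assume "S \<in> P" "T \<in> P" "S \<noteq> T"
      hence "S \<inter> T = {}" using assms by (auto simp: packing_def disjoint_def)
      show "nsets S 2 \<inter> nsets T 2 = {}"
      proof (rule ccontr)
        assume "nsets S 2 \<inter> nsets T 2 \<noteq> {}"
        then obtain e where "e \<subseteq> S" "e \<subseteq> T" "card e = 2" by (auto simp: nsets_2_iff)
        moreover have "e \<noteq> {}" using \<open>card e = 2\<close> by auto
        ultimately show False using \<open>S \<inter> T = {}\<close> by blast
      qed
    qed
  qed
  also have "\<dots> = 3 * card P"
    using assms sum.cong[of P P "\<lambda>T. card (nsets T 2)" "\<lambda>_. 3"] card_nsets_triple
    by (fastforce simp: packing_def)
  finally show ?thesis .
qed

text \<open>A tiling of \<open>V\<close> has a third as many triples as \<open>V\<close> has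
  vertices and three edges per triple, hence exactly \<open>card V\<close> edges; the others are
  waste.\<close>

lemma waste_triples:
  assumes "triples V P" "finite V" "finite E" "pairs P \<subseteq> E"
  shows "card (inside E V) = waste E V P + card V"
proof -
  have sub: "pairs P \<subseteq> inside E V"
  proof
    fix e assume e: "e \<in> pairs P"
    then obtain T where "T \<in> P" "e \<subseteq> T" by (auto simp: in_pairs_iff)
    moreover have "\<Union>P = V" using assms(1) by (simp add: triples_def partition_on_def)
    ultimately show "e \<in> inside E V" using e assms(4) by (auto simp: inside_def)
  qed
  have "card (pairs P) = card V"
    using card_pairs_triples[OF triples_packing[OF assms(1) order.refl]] triples_card[OF assms(1,2)] by simp
  moreover have "finite (inside E V)" using assms(3) inside_subset finite_subset by blast
  ultimately show ?thesis
    unfolding waste_def using card_Diff_subset[of "pairs P" "inside E V"] sub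
      card_mono[of "inside E V" "pairs P"] finite_subset[OF sub] by simp
qed

section \<open>Connected components, and edge counts in those that are tiled\<close>

lemma component_disjoint:
  assumes "component N E U" "component N E V" "U \<inter> V \<noteq> {}"
  shows "U = V"
proof -
  have "edge_closed E (U \<inter> V)"
    using assms component_closed edge_closed_Int by metis
  hence "U \<inter> V = U" "U \<inter> V = V"
    using assms component_minimal[of N E U "U \<inter> V"] component_minimal[of N E V "U \<inter> V"] by auto
  thus ?thesis by simp
qed

text \<open>The component is the intersection of all closed sets containing \<open>v\<close>. A
  closed subset missing \<open>v\<close> must be empty, since its complement in the intersection is
  again closed and contains \<open>v\<close>.\<close>

lemma component_exists:
  assumes "E \<subseteq> nsets N 2" "v \<in> N"
  obtains V where "component N E V" "v \<in> V"
proof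
  define F where "F = {A. A \<subseteq> N \<and> v \<in> A \<and> edge_closed E A}"
  have "edge_closed E N" using assms by (auto simp: edge_closed_def nsets_def)
  hence N: "N \<in> F" using assms by (simp add: F_def)
  show v: "v \<in> \<Inter>F" by (auto simp: F_def)
  have cl: "edge_closed E (\<Inter>F)"
    unfolding edge_closed_def F_def by blast
  have "A = {} \<or> A = \<Inter>F" if A: "A \<subseteq> \<Inter>F" "edge_closed E A" for A
  proof (cases "v \<in> A")
    case True
    hence "A \<in> F" using A N by (auto simp: F_def)
    thus ?thesis using A by blast
  next
    case False
    have "edge_closed E (\<Inter>F - A)"
      using cl A(2) by (rule edge_closed_Diff)
    hence "\<Inter>F - A \<in> F" using False v N by (auto simp: F_def)
    thus ?thesis using A by blast
  qed
  thus "component N E (\<Inter>F)"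
    using N v cl by (auto simp: component_def)
qed

text \<open>A component tiled by \<open>k\<close> triangles needs at least \<open>k - 1\<close> further edges to connect them.\<close>

lemma component_card_edges:
  assumes fin: "finite N" and E: "E \<subseteq> nsets N 2" and V: "component N E V"
    and P: "triples V P" "pairs P \<subseteq> E"
  shows "4 * card P \<le> card (inside E V) + 1"
proof -
  have finV: "finite V" using fin component_subset[OF V] finite_subset by blast
  have finE: "finite (inside E S)" for S
    using finite_subset[OF inside_subset finite_pairs_graph[OF fin E]] .
  have UP: "\<Union>P = V" and dj: "disjoint P" using P by (auto simp: triples_def partition_on_def)
  have finP: "finite P" using triples_card P finV by blast
  have T3: "card (nsets T 2) = 3" "nsets T 2 \<subseteq> inside E T" "T \<noteq> {}" if "T \<in> P" for T
  proof -
    have c: "card T = 3" using that P by (auto simp: triples_def)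
    show "card (nsets T 2) = 3" using c by (rule card_nsets_triple)
    show "nsets T 2 \<subseteq> inside E T" using that P by (auto simp: inside_def pairs_def nsets_2_iff)
    show "T \<noteq> {}" using c by auto
  qed
  have "V \<noteq> {}" using V by (simp add: component_def)
  hence "P \<noteq> {}" using UP by auto
  \<comment> \<open>Tiles are collected one at a time, starting from a single triangle with its
    three edges. While some tile is missing, minimality of \<open>V\<close> yields an edge leaving
    the current union; it leads to a new tile, and this edge and the three edges of the tile are
    four new ones.\<close>
  have grow: "\<exists>Q\<subseteq>P. card Q = Suc j \<and> 4 * Suc j \<le> card (inside E (\<Union>Q)) + 1" if "Suc j \<le> card P" for j
    using that
  proof (induction j)
    case 0
    obtain T where "T \<in> P" using \<open>P \<noteq> {}\<close> by blast
    hence "{T} \<subseteq> P \<and> card {T} = Suc 0 \<and> 4 * Suc 0 \<le> card (inside E (\<Union>{T})) + 1"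
      using T3[of T] card_mono[OF finE, of "nsets T 2" T] by simp
    thus ?case by blast
  next
    case (Suc j)
    then obtain Q where Q: "Q \<subseteq> P" "card Q = Suc j" "4 * Suc j \<le> card (inside E (\<Union>Q)) + 1" by auto
    have "Q \<noteq> P" using Q Suc.prems by auto
    then obtain T0 where T0: "T0 \<in> P" "T0 \<notin> Q" using Q(1) by blast
    have "T0 \<inter> \<Union>Q = {}" using T0 Q(1) dj by (fastforce simp: disjoint_def)
    moreover have "T0 \<subseteq> V" using T0 UP by blast
    ultimately have "\<Union>Q \<noteq> V" using T3(3)[OF T0(1)] by blast
    moreover have "\<Union>Q \<noteq> {}"
    proof -
      have "Q \<noteq> {}" using Q(2) by auto
      thus ?thesis using T3(3) Q(1) by blast
    qed
    moreover have "\<Union>Q \<subseteq> V" using Q(1) UP by blast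
    ultimately have "\<not> edge_closed E (\<Union>Q)" using component_minimal[OF V] by blast
    then obtain e where e: "e \<in> E" "e \<inter> \<Union>Q \<noteq> {}" "\<not> e \<subseteq> \<Union>Q" by (auto simp: edge_closed_def)
    obtain a b where ab: "a \<in> e" "a \<in> \<Union>Q" "b \<in> e" "b \<notin> \<Union>Q" using e by blast
    have "e \<subseteq> V"
      using edge_closedD[OF component_closed[OF V] e(1) ab(1)] ab(2) \<open>\<Union>Q \<subseteq> V\<close> by blast
    have "card e = 2" using e E by (auto simp: nsets_def)
    hence eab: "e = {a, b}" using ab by (auto simp: card_2_iff)
    obtain T where T: "T \<in> P" "b \<in> T" using ab \<open>e \<subseteq> V\<close> UP by blast
    have "T \<notin> Q" using T ab by blast
    have TQ: "T \<inter> \<Union>Q = {}" using T \<open>T \<notin> Q\<close> Q(1) dj by (fastforce simp: disjoint_def)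
    have dis1: "inside E (\<Union>Q) \<inter> nsets T 2 = {}"
    proof (rule ccontr)
      assume "inside E (\<Union>Q) \<inter> nsets T 2 \<noteq> {}"
      then obtain g where "g \<subseteq> \<Union>Q" "g \<subseteq> T" "card g = 2" by (auto simp: inside_def nsets_2_iff)
      moreover have "g \<noteq> {}" using \<open>card g = 2\<close> by auto
      ultimately show False using TQ by blast
    qed
    have eT: "e \<notin> nsets T 2" using ab TQ by (auto simp: nsets_2_iff)
    have eQ: "e \<notin> inside E (\<Union>Q)" using ab by (auto simp: inside_def)
    have "insert e (inside E (\<Union>Q) \<union> nsets T 2) \<subseteq> inside E (\<Union>(insert T Q))"
      using e eab ab T T3(2)[OF T(1)] by (auto simp: inside_def)
    hence "card (insert e (inside E (\<Union>Q) \<union> nsets T 2)) \<le> card (inside E (\<Union>(insert T Q)))"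
      by (rule card_mono[OF finE])
    moreover have "finite (nsets T 2)" using T3(1)[OF T(1)] by (simp add: card_ge_0_finite)
    ultimately have "card (inside E (\<Union>Q)) + 4 \<le> card (inside E (\<Union>(insert T Q)))"
      using dis1 eT eQ finE T3(1)[OF T(1)] by (simp add: card_Un_disjoint)
    moreover have "card (insert T Q) = Suc (Suc j)"
      using Q \<open>T \<notin> Q\<close> finP finite_subset by (metis card_insert_disjoint)
    ultimately show ?case
      using Q T(1) by (intro exI[of _ "insert T Q"]) auto
  qed
  have "card P \<noteq> 0" using finP \<open>P \<noteq> {}\<close> by simp
  then obtain j where j: "card P = Suc j" by (cases "card P") auto
  then obtain Q where Q: "Q \<subseteq> P" "card Q = card P" "4 * card P \<le> card (inside E (\<Union>Q)) + 1"
    using grow[of j] by auto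
  have "Q = P" using Q finP card_subset_eq by blast
  thus ?thesis using Q UP by simp
qed

text \<open>The detour through \<open>z\<close> still connects \<open>x\<close> and
  \<open>y\<close>, so deleting \<open>{x, y}\<close> creates no new closed sets.\<close>

lemma component_remove_triangle_edge:
  assumes "component N E V" "{x, z} \<in> E" "{z, y} \<in> E"
    "x \<noteq> z" "y \<noteq> z" "x \<noteq> y"
  shows "component N (E - {{x, y}}) V"
proof -
  have "edge_closed E A" if A: "edge_closed (E - {{x, y}}) A" for A
  proof -
    have "z \<notin> {x, y}" using assms(4,5) by simp
    hence "{x, z} \<noteq> {x, y}" "{z, y} \<noteq> {x, y}" by blast+
    hence "{x, z} \<in> E - {{x, y}}" "{z, y} \<in> E - {{x, y}}"
      using assms(2,3) by blast+
    note edge_closedD[OF A this(1)] edge_closedD[OF A this(2)]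
    hence xy: "x \<in> A \<longleftrightarrow> y \<in> A" by (meson insertCI insert_subset)
    show ?thesis
    proof (rule edge_closedI)
      fix e v assume e: "e \<in> E" "v \<in> e" "v \<in> A"
      show "e \<subseteq> A"
      proof (cases "e = {x, y}")
        case True
        thus ?thesis using e(2,3) xy by blast
      next
        case False
        thus ?thesis using edge_closedD[OF A, of e v] e by simp
      qed
    qed
  qed
  moreover have "edge_closed (E - {{x, y}}) V"
    using component_closed[OF assms(1)] by (rule edge_closed_mono) auto
  ultimately show ?thesis
    using assms(1) by (simp add: component_def)
qed

text \<open>With only \<open>k - 1\<close> connecting edges, each of them is a bridge, so no triangle uses them.\<close>

lemma tight_component_triangle:
  assumes fin: "finite N" and E: "E \<subseteq> nsets N 2" and V: "component N E V"
    and P: "triples V P" "pairs P \<subseteq> E" and tight: "card (inside E V) + 1 = 4 * card P"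
    and T: "T \<subseteq> V" "card T = 3" "nsets T 2 \<subseteq> E"
  shows "T \<in> P"
proof (rule ccontr)
  assume "T \<notin> P"
  have UP: "\<Union>P = V" using P by (auto simp: triples_def partition_on_def)
  have dj: "S = S'" if "S \<in> P" "S' \<in> P" "v \<in> S" "v \<in> S'" for S S' v
    using P that by (auto simp: triples_def partition_on_def disjoint_def)
  obtain x where x: "x \<in> T" using T(2) by fastforce
  then obtain S where S: "S \<in> P" "x \<in> S" using T UP by blast
  have cS: "card S = 3" using S P by (auto simp: triples_def)
  have "\<not> T \<subseteq> S"
    using card_subset_eq[of S T] cS T(2) S \<open>T \<notin> P\<close> by (metis card_ge_0_finite zero_less_numeral)
  then obtain y where y: "y \<in> T" "y \<notin> S" by blast
  have "x \<noteq> y" using y S by blast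
  have "card (T - {x, y}) = 1" using T(2) x y \<open>x \<noteq> y\<close> by (simp add: card_Diff_subset)
  then obtain z where z: "z \<in> T" "z \<noteq> x" "z \<noteq> y" by (metis card_1_singletonE Diff_iff insertI1 insert_iff)
  have inE: "{x, z} \<in> E" "{z, y} \<in> E" "{x, y} \<in> E"
    using T(3) x y z \<open>x \<noteq> y\<close> by (auto simp: nsets_2_iff subset_iff)
  \<comment> \<open>As \<open>x\<close> and \<open>y\<close> lie in different tiles, the tiling
    survives the deletion of \<open>{x, y}\<close>, and so does connectedness, because of
    \<open>z\<close>. But then only \<open>4k - 2\<close> edges remain, where
    \<open>k = card P\<close>, one fewer than a tiled component needs.\<close>
  have "{x, y} \<notin> pairs P"
    using S y dj by (auto simp: in_pairs_iff)
  hence "pairs P \<subseteq> E - {{x, y}}" using P by blast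
  moreover have "component N (E - {{x, y}}) V"
    using component_remove_triangle_edge[OF V inE(1,2)] z \<open>x \<noteq> y\<close> by auto
  ultimately have "4 * card P \<le> card (inside (E - {{x, y}}) V) + 1"
    using component_card_edges[OF fin _ _ P(1)] E by blast
  moreover have "inside (E - {{x, y}}) V = inside E V - {{x, y}}" by (auto simp: inside_def)
  moreover have "{x, y} \<in> inside E V" using inE x y T by (auto simp: inside_def)
  moreover have "finite (inside E V)"
    using finite_subset[OF inside_subset finite_pairs_graph[OF fin E]] .
  ultimately show False using tight
    by (metis add.commute card_Diff1_less less_add_same_cancel1 linorder_not_less nat_add_left_cancel_less)
qed

text \<open>If \<open>f\<close> would complete a tight tiled component but is lost, the triangles already present are
  the only ones available, so the remaining three vertices cause one more wasted edge.\<close>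

lemma lost_edge_waste:
  assumes fin: "finite N" and E: "insert f E \<subseteq> nsets N 2" and "f \<notin> E" "f \<subseteq> V"
    and VE: "component N E V" and V: "component N (insert f E) V"
    and P: "triples V P" "pairs P \<subseteq> insert f E"
    and tight: "card (inside (insert f E) V) + 1 = 4 * card P"
    and Q: "packing N Q" "f \<notin> pairs Q"
  shows "card P \<le> waste E V Q"
proof -
  have finV: "finite V" using fin component_subset[OF V] finite_subset by blast
  have finE: "finite (inside E S)" for S
    using finite_subset[OF inside_subset finite_pairs_graph[OF fin]] E by blast
  have finP: "finite P" "card V = 3 * card P" using triples_card P finV by blast+
  have UP: "\<Union>P = V" and P3: "\<And>T. T \<in> P \<Longrightarrow> card T = 3"
    using P by (auto simp: triples_def partition_on_def)
  have finQ: "finite Q"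
    using Q fin by (auto simp: packing_def intro: finite_UnionD finite_subset)
  have djQ: "\<And>S T. S \<in> Q \<Longrightarrow> T \<in> Q \<Longrightarrow> S \<noteq> T \<Longrightarrow> S \<inter> T = {}" and Q3: "\<And>T. T \<in> Q \<Longrightarrow> card T = 3"
    using Q by (auto simp: packing_def disjoint_def)
  have f2: "card f = 2" using E by (auto simp: nsets_def)
  have "inside (insert f E) V = insert f (inside E V)" using \<open>f \<subseteq> V\<close> by (auto simp: inside_def)
  hence cE: "card (inside E V) + 2 = 4 * card P"
    using tight \<open>f \<notin> E\<close> finE by (simp add: inside_def)
  \<comment> \<open>Without \<open>f\<close> there are only \<open>4k - 2\<close> edges, too few for
    the component \<open>V\<close> of \<open>E\<close> to be tiled within \<open>E\<close>.\<close>
  have "f \<in> pairs P"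
  proof (rule ccontr)
    assume "f \<notin> pairs P"
    hence "pairs P \<subseteq> E" using P by blast
    thus False using component_card_edges[OF fin _ VE P(1)] E cE by simp
  qed
  then obtain T0 where T0: "T0 \<in> P" "f \<subseteq> T0" by (auto simp: in_pairs_iff)
  \<comment> \<open>\<open>A\<close> collects the triples of \<open>Q\<close> that are complete
    triangles of \<open>E\<close> in \<open>V\<close>; by tightness they are tiles of
    \<open>P\<close>, and \<open>T0\<close> is not among them because it contains the missing edge
    \<open>f\<close>. \<open>B\<close> collects the other triples that use some edge inside
    \<open>V\<close>. A triple of \<open>A\<close> uses three edges on three vertices, whereas one
    of \<open>B\<close> uses fewer edges than it has vertices in \<open>V\<close>.\<close>
  define A where "A = {T \<in> Q. T \<subseteq> V \<and> nsets T 2 \<subseteq> E}"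
  define B where "B = {T \<in> Q. T \<notin> A \<and> inside E (T \<inter> V) \<noteq> {}}"
  have fAB: "finite A" "finite B" "A \<inter> B = {}" "A \<subseteq> Q" "B \<subseteq> Q"
    using finQ by (auto simp: A_def B_def)
  have "A \<subseteq> P - {T0}"
  proof
    fix T assume T: "T \<in> A"
    have "T \<in> P"
      using tight_component_triangle[OF fin E V P tight, of T] T Q3 by (auto simp: A_def)
    moreover have "T \<noteq> T0" using T T0 f2 \<open>f \<notin> E\<close> by (auto simp: A_def nsets_2_iff subset_iff)
    ultimately show "T \<in> P - {T0}" by simp
  qed
  have cP: "card (P - {T0}) + 1 = card P" using T0 finP
    by (metis Suc_eq_plus1 card.remove)
  have cA: "card A + 1 \<le> card P"
    using card_mono[OF _ \<open>A \<subseteq> P - {T0}\<close>] finP cP by simp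
  have sub2: "inside E S \<subseteq> nsets S 2" for S using E by (auto simp: inside_def nsets_2_iff)
  have uA: "card (inside E (T \<inter> V)) \<le> 3" "card (T \<inter> V) = 3" if "T \<in> A" for T
  proof -
    have "T \<inter> V = T" "card T = 3" using that Q3 by (auto simp: A_def)
    thus "card (inside E (T \<inter> V)) \<le> 3" "card (T \<inter> V) = 3"
      using card_mono[OF _ sub2[of T]] card_nsets_triple[of T]
      by (simp_all add: card_ge_0_finite)
  qed
  have uB: "card (inside E (T \<inter> V)) + 1 \<le> card (T \<inter> V)" if T: "T \<in> B" for T
  proof -
    have T3: "card T = 3" using T Q3 by (auto simp: B_def)
    have fT: "finite T" using T3 by (simp add: card_ge_0_finite)
    have le: "card (inside E (T \<inter> V)) \<le> card (T \<inter> V) choose 2"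
      using card_mono[OF _ sub2[of "T \<inter> V"]] fT by (simp add: card_nsets finite_imp_finite_nsets)
    have "inside E (T \<inter> V) \<noteq> {}" using T by (simp add: B_def)
    hence pos: "card (inside E (T \<inter> V)) > 0" using finE by (simp add: card_gt_0_iff)
    have "card (T \<inter> V) \<le> 3" using T3 fT by (metis card_mono Int_lower1)
    then consider "card (T \<inter> V) = 0" | "card (T \<inter> V) = 1" | "card (T \<inter> V) = 2" | "card (T \<inter> V) = 3"
      by linarith
    thus ?thesis
    proof cases
      case 4
      hence "T \<inter> V = T" using T3 fT by (metis card_subset_eq Int_lower1)
      hence "T \<subseteq> V" by blast
      hence "\<not> nsets T 2 \<subseteq> E" using T by (auto simp: A_def B_def)
      hence "inside E T \<subset> nsets T 2" using sub2[of T] by (auto simp: inside_def)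
      hence "card (inside E T) < card (nsets T 2)" using fT by (intro psubset_card_mono finite_imp_finite_nsets)
      thus ?thesis using 4 \<open>T \<inter> V = T\<close> card_nsets_triple[OF T3] by simp
    qed (use le pos in \<open>simp_all add: numeral_eq_Suc\<close>)
  qed
  have "(\<Sum>T\<in>A \<union> B. card (T \<inter> V)) = card (\<Union>T\<in>A \<union> B. T \<inter> V)"
    using fAB finV djQ by (intro card_UN_disjoint[symmetric]) blast+
  also have "\<dots> \<le> card V" by (intro card_mono finV) auto
  finally have tot: "3 * card A + (\<Sum>T\<in>B. card (T \<inter> V)) \<le> 3 * card P"
    using fAB uA(2) finP(2) by (simp add: sum.union_disjoint)
  define used where "used = inside E V \<inter> pairs Q"
  have "used \<subseteq> (\<Union>T\<in>A \<union> B. inside E (T \<inter> V))"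
  proof
    fix e assume "e \<in> used"
    then obtain T where T: "T \<in> Q" "e \<subseteq> T" "e \<in> E" "e \<subseteq> V"
      by (auto simp: used_def inside_def in_pairs_iff)
    hence "e \<in> inside E (T \<inter> V)" by (auto simp: inside_def)
    thus "e \<in> (\<Union>T\<in>A \<union> B. inside E (T \<inter> V))" using T(1) by (auto simp: B_def)
  qed
  hence "card used \<le> card (\<Union>T\<in>A \<union> B. inside E (T \<inter> V))"
    using fAB finE by (intro card_mono) auto
  also have "\<dots> \<le> (\<Sum>T\<in>A \<union> B. card (inside E (T \<inter> V)))"
    using fAB by (intro card_UN_le) auto
  also have "\<dots> = (\<Sum>T\<in>A. card (inside E (T \<inter> V))) + (\<Sum>T\<in>B. card (inside E (T \<inter> V)))"
    using fAB by (simp add: sum.union_disjoint)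
  also have "(\<Sum>T\<in>A. card (inside E (T \<inter> V))) \<le> 3 * card A"
    using sum_bounded_above[of A "\<lambda>T. card (inside E (T \<inter> V))" 3] uA(1) by simp
  finally have used: "card used \<le> 3 * card A + (\<Sum>T\<in>B. card (inside E (T \<inter> V)))" by simp
  have "(\<Sum>T\<in>B. card (inside E (T \<inter> V)) + 1) \<le> (\<Sum>T\<in>B. card (T \<inter> V))"
    using uB by (rule sum_mono)
  hence sB: "(\<Sum>T\<in>B. card (inside E (T \<inter> V))) + card B \<le> (\<Sum>T\<in>B. card (T \<inter> V))"
    unfolding sum.distrib by simp
  \<comment> \<open>It suffices that at most \<open>3k - 2\<close> of the \<open>4k - 2\<close>
    edges are used. If \<open>B\<close> is empty, \<open>A\<close> contributes at most
    \<open>3(k - 1)\<close>. If \<open>B\<close> has two or more members, each loses at least one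
    edge against the vertex total \<open>3k\<close>. Only a single member of \<open>B\<close> needs
    a closer look.\<close>
  have "card used + 2 \<le> 3 * card P"
  proof -
    consider "card B = 0" | "card B = 1" | "card B \<ge> 2" by linarith
    thus ?thesis
    proof cases
      case 1
      hence "B = {}" using fAB by simp
      thus ?thesis using used cA by simp
    next
      case 2
      then obtain T where BT: "B = {T}" by (auto simp: card_1_singleton_iff)
      have TQ: "T \<in> Q" "T \<notin> A" using BT fAB by blast+
      have T3: "card T = 3" using TQ Q3 by blast
      have fT: "finite T" using T3 by (simp add: card_ge_0_finite)
      have u: "card (inside E (T \<inter> V)) + 1 \<le> card (T \<inter> V)" using uB BT by blast
      have le3: "card (T \<inter> V) \<le> 3" using T3 fT by (metis card_mono Int_lower1)
      show ?thesis
      proof (cases "card A + 1 = card P")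
        case True
        \<comment> \<open>Now \<open>A\<close> covers everything in \<open>V\<close> except
          \<open>T0\<close>, so \<open>T\<close> meets \<open>V\<close> only within
          \<open>T0\<close>. Three common vertices would force \<open>T = T0\<close>, putting
          \<open>f\<close> into \<open>pairs Q\<close>; hence there are at most two, and
          \<open>T\<close> uses at most one edge.\<close>
        hence "A = P - {T0}"
          using \<open>A \<subseteq> P - {T0}\<close> cP finP by (intro card_subset_eq) auto
        hence V_split: "V \<subseteq> \<Union>A \<union> T0" using UP by blast
        have "T \<inter> \<Union>A = {}" using djQ TQ fAB(4) by blast
        hence sub: "T \<inter> V \<subseteq> T0" using V_split by blast
        have fT0: "finite T0" using P3[OF T0(1)] by (simp add: card_ge_0_finite)
        have "card (T \<inter> V) \<noteq> 3"
        proof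
          assume c: "card (T \<inter> V) = 3"
          hence "T \<inter> V = T" using T3 fT by (metis card_subset_eq Int_lower1)
          moreover have "T \<inter> V = T0" using sub c P3[OF T0(1)] fT0 by (metis card_subset_eq)
          ultimately show False using Q(2) T0(2) TQ(1) f2 by (auto simp: in_pairs_iff)
        qed
        hence "card (inside E (T \<inter> V)) \<le> 1" using u le3 by simp
        thus ?thesis using used BT cA by simp
      next
        case False
        thus ?thesis using used BT cA u le3 by simp
      qed
    next
      case 3
      thus ?thesis using used sB tot by linarith
    qed
  qed
  moreover have "waste E V Q = card (inside E V) - card used"
    unfolding waste_def used_def by (simp add: card_Diff_subset_Int finE)
  ultimately show ?thesis using cE by linarith
qed

section \<open>Preservation of the invariant\<close>

lemma finite_bad: "finite N \<Longrightarrow> finite {V. bad N E R V}"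
  by (rule finite_subset[of _ "Pow N"]) (auto simp: bad_def dest: component_subset)

lemma waste_mono:
  assumes "finite E'" "E \<subseteq> E'" shows "waste E V P \<le> waste E' V P"
  unfolding waste_def using assms by (intro card_mono) (auto simp: inside_def)

lemma delay_invD:
  assumes "delay_inv N E R"
  shows "E \<subseteq> nsets N 2" "R \<subseteq> nsets N 2" "E \<inter> R = {}"
    "edge_closed E V \<Longrightarrow> f \<in> R \<Longrightarrow> v \<in> f \<Longrightarrow> v \<in> V \<Longrightarrow> f \<subseteq> V"
    "edge_closed E V \<Longrightarrow> packing N P \<Longrightarrow> pairs P \<inter> R = {} \<Longrightarrow> card (inside R V) \<le> waste E V P"
    "card {V. bad N E R V} \<le> card R"
proof -
  assume "edge_closed E V" "f \<in> R" "v \<in> f" "v \<in> V"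
  thus "f \<subseteq> V" using assms unfolding delay_inv_def by (meson disjoint_iff)
qed (use assms in \<open>simp_all add: delay_inv_def\<close>)

text \<open>The new edge cannot be a bridge: outside the factor it would raise the waste to at least
  one more than the \<open>k - 1\<close> registered edges, while a bad component wastes only
  \<open>k - 1\<close>. So \<open>f\<close> completes a factor triangle, and the other two sides
  already connect its ends.\<close>

lemma bad_move_component:
  assumes fin: "finite N" and inv: "delay_inv N E R" and f: "f \<in> nsets N 2" "f \<notin> E" "f \<notin> R" "f \<subseteq> V"
    and bad: "bad N (insert f E) R V"
  shows "component N E V"
proof -
  note I = delay_invD[OF inv]
  from bad obtain P where V: "component N (insert f E) V" and P: "triples V P" "pairs P \<subseteq> insert f E"
    and c: "card (inside (insert f E) V) + 1 = 4 * card P" "card (inside R V) + 1 = card P"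
    by (auto simp: bad_def)
  have finV: "finite V" using fin component_subset[OF V] finite_subset by blast
  have finE: "finite (insert f E)" using finite_pairs_graph[OF fin I(1)] by simp
  have f2: "card f = 2" using f(1) by (simp add: nsets_2_iff)
  have "f \<in> pairs P"
  proof (rule ccontr)
    assume nf: "f \<notin> pairs P"
    have "inside (insert f E) V - pairs P = insert f (inside E V - pairs P)"
      using nf f(4) by (auto simp: inside_def)
    moreover have "f \<notin> inside E V - pairs P" using f(2) by (simp add: inside_def)
    moreover have "finite (inside E V - pairs P)"
      using finE finite_subset[OF inside_subset] by auto
    ultimately have "waste (insert f E) V P = waste E V P + 1" by (simp add: waste_def)
    moreover have "pairs P \<inter> R = {}" using P(2) I(3) f(3) by blast
    hence "card (inside R V) \<le> waste E V P"
      using I(5)[OF edge_closed_mono[OF component_closed[OF V]]]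
        triples_packing[OF P(1) component_subset[OF V]] by blast
    moreover have "card (inside (insert f E) V) = waste (insert f E) V P + 3 * card P"
      using waste_triples[OF P(1) finV finE P(2)] triples_card(2)[OF P(1) finV] by simp
    ultimately show False using c by linarith
  qed
  then obtain T where T: "T \<in> P" "f \<subseteq> T" by (auto simp: in_pairs_iff)
  have T3: "card T = 3" using T(1) P(1) by (simp add: triples_def)
  obtain x y where xy: "f = {x, y}" "x \<noteq> y" using f2 by (auto simp: card_2_iff)
  have "card (T - f) = 1" using T T3 f2 by (simp add: card_Diff_subset card_ge_0_finite)
  then obtain z where "T - f = {z}" by (auto simp: card_1_singleton_iff)
  hence z: "z \<in> T" "z \<noteq> x" "z \<noteq> y" using xy by auto
  have "{x, z} \<in> pairs P" "{z, y} \<in> pairs P"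
    using T z xy by (auto simp: in_pairs_iff)
  hence "{x, z} \<in> insert f E" "{z, y} \<in> insert f E" using P(2) by blast+
  hence "component N (insert f E - {{x, y}}) V"
    using component_remove_triangle_edge[OF V] z xy(2) by metis
  moreover have "insert f E - {{x, y}} = E" using xy f(2) by auto
  ultimately show ?thesis by simp
qed

lemma bad_untouched:
  assumes "bad N (insert e E) R V" "e \<inter> V = {}" "e \<noteq> {}"
  shows "bad N E R V"
proof -
  from assms(1) obtain P where V: "component N (insert e E) V" and P: "triples V P" "pairs P \<subseteq> insert e E"
    and c: "card (inside (insert e E) V) + 1 = 4 * card P" "card (inside R V) + 1 = card P"
    by (auto simp: bad_def)
  have "component N E V"
  proof (rule componentI)
    show "V \<subseteq> N" "V \<noteq> {}" using component_subset[OF V] component_nonempty[OF V] by auto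
    show "edge_closed E V" using component_closed[OF V] by (rule edge_closed_mono) auto
    fix A assume A: "A \<subseteq> V" "edge_closed E A" "A \<noteq> {}"
    hence "edge_closed (insert e E) A" using assms(2) by (auto simp: edge_closed_def)
    thus "A = V" using component_minimal[OF V A(1)] A(3) by blast
  qed
  moreover have eV: "\<not> e \<subseteq> V" using assms(2,3) by blast
  hence "inside (insert e E) V = inside E V" by (auto simp: inside_def)
  moreover have "\<Union>P = V" using P(1) by (simp add: triples_def partition_on_def)
  hence "e \<notin> pairs P" using eV by (auto simp: in_pairs_iff)
  hence "pairs P \<subseteq> E" using P(2) by blast
  ultimately show ?thesis using P c by (auto simp: bad_def)
qed

text \<open>A bad component after the move either contains \<open>e\<close>, which is excluded by
  assumption, or avoids \<open>e\<close> and was bad before. The other clauses are monotone: adding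
  an edge leaves fewer closed sets and no less waste.\<close>

lemma delay_inv_take:
  assumes fin: "finite N" and inv: "delay_inv N E R" and e: "e \<in> nsets N 2" "e \<notin> R"
    and good: "\<not> bad_move N E R e"
  shows "delay_inv N (insert e E) R"
proof -
  note I = delay_invD[OF inv]
  have cl: "edge_closed E V" if "edge_closed (insert e E) V" for V
    using that by (rule edge_closed_mono) auto
  have finE: "finite (insert e E)" using finite_pairs_graph[OF fin I(1)] by simp
  have "e \<noteq> {}" using e by (auto simp: nsets_def)
  have "{V. bad N (insert e E) R V} \<subseteq> {V. bad N E R V}"
  proof clarify
    fix V assume V: "bad N (insert e E) R V"
    hence "\<not> e \<subseteq> V" using good by (auto simp: bad_move_def)
    moreover have "edge_closed (insert e E) V" using V component_closed by (auto simp: bad_def)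
    ultimately have "e \<inter> V = {}" by (auto simp: edge_closed_def)
    thus "bad N E R V" using bad_untouched[OF V] \<open>e \<noteq> {}\<close> by simp
  qed
  hence "card {V. bad N (insert e E) R V} \<le> card R"
    using I(6) card_mono[OF finite_bad[OF fin]] le_trans by blast
  moreover have "card (inside R V) \<le> waste (insert e E) V P"
    if "edge_closed (insert e E) V" "packing N P" "pairs P \<inter> R = {}" for V P
    using I(5)[OF cl[OF that(1)] that(2,3)] waste_mono[OF finE subset_insertI, of V P] by auto
  moreover have "f \<subseteq> V" if "edge_closed (insert e E) V" "f \<in> R" "f \<inter> V \<noteq> {}" for V f
    using I(4)[OF cl[OF that(1)] that(2)] that(3) by blast
  ultimately show ?thesis
    unfolding delay_inv_def using I(1-3) e by simp
qed

text \<open>Losing \<open>f\<close> forces any packing that avoids it to waste \<open>k\<close>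
  edges in the component \<open>V0\<close> that \<open>f\<close> would have made bad. Only
  \<open>k - 1\<close> edges were registered there, so there is room for \<open>f\<close>. Taking
  \<open>e\<close> can create one new bad component, which the registration of \<open>f\<close> pays
  for.\<close>

lemma delay_inv_register:
  assumes fin: "finite N" and inv: "delay_inv N E R" and e: "e \<in> nsets N 2" "e \<notin> R"
    and f: "f \<in> nsets N 2" "f \<notin> E" "f \<notin> R" and "e \<noteq> f" and badf: "bad_move N E R f"
  shows "delay_inv N (insert e E) (insert f R)"
proof -
  note I = delay_invD[OF inv]
  have cl: "edge_closed E V" if "edge_closed (insert e E) V" for V
    using that by (rule edge_closed_mono) auto
  have finE: "finite (insert e E)" using finite_pairs_graph[OF fin I(1)] by simp
  have finR: "finite R" using finite_pairs_graph[OF fin I(2)] .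
  have fins: "finite (inside E V)" "finite (inside R V)" for V
    using finE finR finite_subset[OF inside_subset] by auto
  have ne: "g \<noteq> {}" if "g \<in> nsets N 2" for g using that by (auto simp: nsets_def)
  from badf obtain V0 where bad: "bad N (insert f E) R V0" and fV0: "f \<subseteq> V0"
    by (auto simp: bad_move_def)
  then obtain P0 where V0: "component N (insert f E) V0" and P0: "triples V0 P0" "pairs P0 \<subseteq> insert f E"
    and c: "card (inside (insert f E) V0) + 1 = 4 * card P0" "card (inside R V0) + 1 = card P0"
    by (auto simp: bad_def)
  have V0E: "component N E V0" using bad_move_component[OF fin inv f fV0 bad] .
  have finV0: "finite V0" using fin component_subset[OF V0] finite_subset by blast
  have V0sub: "V0 \<subseteq> V" if "edge_closed E V" "f \<inter> V \<noteq> {}" for V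
  proof -
    have "edge_closed E (V0 \<inter> V)" using component_closed[OF V0E] that(1) by (rule edge_closed_Int)
    thus ?thesis using component_minimal[OF V0E, of "V0 \<inter> V"] that(2) fV0 by blast
  qed
  have "card (inside (insert f R) V) \<le> waste (insert e E) V P"
    if V: "edge_closed (insert e E) V" and P: "packing N P" "pairs P \<inter> insert f R = {}" for V P
  proof (cases "f \<subseteq> V")
    case False
    hence "inside (insert f R) V = inside R V" by (auto simp: inside_def)
    thus ?thesis using I(5)[OF cl[OF V] P(1)] P(2) waste_mono[OF finE subset_insertI, of V P] by auto
  next
    case True
    \<comment> \<open>The bound is proved separately on \<open>V0\<close>, using the lost edge, and
      on the closed set \<open>V - V0\<close>, using the old invariant. No edge of \<open>E\<close>
      or \<open>R\<close> runs between the two.\<close>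
    hence sub: "V0 \<subseteq> V" using V0sub[OF cl[OF V]] ne[OF f(1)] by blast
    have "inside (insert f R) V \<subseteq> insert f (inside R V0 \<union> inside R (V - V0))"
      using I(4)[OF component_closed[OF V0E]] by (auto simp: inside_def)
    hence "card (inside (insert f R) V) \<le> card (insert f (inside R V0 \<union> inside R (V - V0)))"
      using fins by (intro card_mono) auto
    also have "\<dots> \<le> 1 + card (inside R V0 \<union> inside R (V - V0))"
      by (simp add: fins card_insert_if)
    also have "\<dots> \<le> 1 + (card (inside R V0) + card (inside R (V - V0)))"
      using card_Un_le by simp
    also have "\<dots> = card P0 + card (inside R (V - V0))" using c by simp
    also have "card P0 \<le> waste E V0 P"
      using lost_edge_waste[OF fin _ f(2) fV0 V0E V0 P0 c(1) P(1)] I(1) f(1) P(2) by blast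
    also have "card (inside R (V - V0)) \<le> waste E (V - V0) P"
      using I(5)[OF edge_closed_Diff[OF cl[OF V] component_closed[OF V0E]] P(1)] P(2) by blast
    also have "waste E V0 P + waste E (V - V0) P
        = card ((inside E V0 - pairs P) \<union> (inside E (V - V0) - pairs P))"
      unfolding waste_def
    proof (rule card_Un_disjoint[symmetric])
      show "(inside E V0 - pairs P) \<inter> (inside E (V - V0) - pairs P) = {}"
      proof (rule ccontr)
        assume "(inside E V0 - pairs P) \<inter> (inside E (V - V0) - pairs P) \<noteq> {}"
        then obtain g where "g \<in> E" "g \<subseteq> V0" "g \<subseteq> V - V0" by (auto simp: inside_def)
        thus False using ne[of g] I(1) by blast
      qed
    qed (use fins in auto)
    also have "\<dots> \<le> waste E V P"
      unfolding waste_def using fins sub by (intro card_mono) (auto simp: inside_def)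
    also have "\<dots> \<le> waste (insert e E) V P"
      using waste_mono[OF finE subset_insertI] .
    finally show ?thesis by simp
  qed
  moreover have "g \<subseteq> V" if V: "edge_closed (insert e E) V" and g: "g \<in> insert f R" "g \<inter> V \<noteq> {}" for V g
  proof (cases "g = f")
    case True
    thus ?thesis using V0sub[OF cl[OF V]] g(2) fV0 by blast
  next
    case False
    thus ?thesis using I(4)[OF cl[OF V], of g] g by blast
  qed
  moreover have "card {V. bad N (insert e E) (insert f R) V} \<le> card (insert f R)"
  proof -
    obtain v where v: "v \<in> e" using ne[OF e(1)] by blast
    have "insert e E \<subseteq> nsets N 2" "v \<in> N" using I(1) e(1) v by (auto simp: nsets_def)
    then obtain Ve where Ve: "component N (insert e E) Ve" "v \<in> Ve" by (rule component_exists)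
    \<comment> \<open>Only the component containing \<open>e\<close> can be newly bad. Any other one
      is a component of \<open>E\<close> as well; if it contains \<open>f\<close> it is
      \<open>V0\<close>, which now has \<open>k\<close> registered edges, one too many, and
      otherwise it was already bad.\<close>
    have "{V. bad N (insert e E) (insert f R) V} \<subseteq> insert Ve {V. bad N E R V}"
    proof
      fix V assume "V \<in> {V. bad N (insert e E) (insert f R) V}"
      hence V: "bad N (insert e E) (insert f R) V" by simp
      have comp: "component N (insert e E) V" using V by (simp add: bad_def)
      have "V = Ve" if nb: "\<not> bad N E R V"
      proof (cases "e \<inter> V = {}")
        case False
        hence "v \<in> V" using component_closed[OF comp] v by (auto simp: edge_closed_def)
        thus ?thesis using component_disjoint[OF comp Ve(1)] Ve(2) by blast
      next
        case True
        hence b: "bad N E (insert f R) V" using bad_untouched[OF V] ne[OF e(1)] by blast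
        have False
        proof (cases "f \<subseteq> V")
          case True
          moreover have "component N E V" using b by (simp add: bad_def)
          ultimately have "V = V0" using component_disjoint[OF _ V0E] fV0 ne[OF f(1)] by blast
          then obtain P where P: "triples V0 P" "card (inside (insert f R) V0) + 1 = card P"
            using b by (auto simp: bad_def)
          have "inside (insert f R) V0 = insert f (inside R V0)" "f \<notin> inside R V0"
            using fV0 f(3) by (auto simp: inside_def)
          hence "card (inside (insert f R) V0) = card (inside R V0) + 1" using fins by simp
          thus False using P c(2) triples_card(2)[OF P(1) finV0] triples_card(2)[OF P0(1) finV0] by simp
        next
          case False
          hence "inside (insert f R) V = inside R V" by (auto simp: inside_def)
          thus False using b nb by (simp add: bad_def)
        qed
        thus ?thesis ..
      qed
      thus "V \<in> insert Ve {V. bad N E R V}" by blast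
    qed
    hence "card {V. bad N (insert e E) (insert f R) V} \<le> card (insert Ve {V. bad N E R V})"
      using finite_bad[OF fin] by (intro card_mono) auto
    also have "\<dots> \<le> Suc (card {V. bad N E R V})" by (simp add: card_insert_if finite_bad[OF fin])
    also have "\<dots> \<le> card (insert f R)" using I(6) f(3) finR by simp
    finally show ?thesis .
  qed
  ultimately show ?thesis
    unfolding delay_inv_def using I(1-3) e f \<open>e \<noteq> f\<close> by simp
qed

lemma delay_inv_empty:
  assumes "finite N" shows "delay_inv N {} {}"
proof -
  have "\<not> bad N {} {} V" for V
  proof
    assume "bad N {} {} V"
    then obtain P where "4 * card P = 1" by (auto simp: bad_def inside_def)
    thus False by presburger
  qed
  thus ?thesis by (auto simp: delay_inv_def inside_def)
qed

section \<open>The final count for a completed factor\<close>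

lemma delay_inv_factor_card:
  assumes fin: "finite N" and inv: "delay_inv N E R" and P: "triples N P" "pairs P \<subseteq> E"
  shows "7 * card N \<le> 6 * card E"
proof -
  note I = delay_invD[OF inv]
  have finE: "finite E" and finR: "finite R" using finite_pairs_graph[OF fin] I by blast+
  define K where "K = {V. component N E V}"
  have finK: "finite K"
    by (rule finite_subset[of _ "Pow N"]) (auto simp: K_def fin dest: component_subset)
  define k where "k V = card {T \<in> P. T \<subseteq> V}" for V
  have UP: "\<Union>P = N" and djP: "disjoint P" and P3: "\<And>T. T \<in> P \<Longrightarrow> card T = 3" and PE: "{} \<notin> P"
    using P(1) by (auto simp: triples_def partition_on_def)
  have part: "triples V {T \<in> P. T \<subseteq> V}" if V: "component N E V" for V
  proof -
    \<comment> \<open>All pairs in a factor triple are edges of \<open>E\<close>, so a triple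
      meeting the closed set \<open>V\<close> cannot leave it.\<close>
    have "T \<subseteq> V" if T: "T \<in> P" "x \<in> T" "x \<in> V" for T x
    proof
      fix y assume "y \<in> T"
      show "y \<in> V"
      proof (cases "y = x")
        case False
        hence "{x, y} \<in> pairs P" using T \<open>y \<in> T\<close> by (auto simp: in_pairs_iff)
        thus ?thesis using edge_closedD[OF component_closed[OF V], of "{x, y}" x] P(2) T(3) by auto
      qed (use T in simp)
    qed
    hence "V \<subseteq> \<Union>{T \<in> P. T \<subseteq> V}" using UP component_subset[OF V] by blast
    hence "\<Union>{T \<in> P. T \<subseteq> V} = V" by blast
    thus ?thesis using djP P3 PE by (auto simp: triples_def partition_on_def disjoint_def)
  qed
  \<comment> \<open>As a component has \<open>w + 3k\<close> edges, this is the inequality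
    \<open>2w - k >= r\<close>, with defect one for bad components, freed of subtraction.\<close>
  have loc: "7 * k V + card (inside R V) \<le> 2 * card (inside E V) + (if bad N E R V then 1 else 0)"
    and k3: "card V = 3 * k V" if "V \<in> K" for V
  proof -
    have V: "component N E V" using that by (simp add: K_def)
    let ?P = "{T \<in> P. T \<subseteq> V}"
    have finV: "finite V" using fin component_subset[OF V] finite_subset by blast
    have PV: "pairs ?P \<subseteq> E" using P(2) by (auto simp: in_pairs_iff subset_iff)
    show k3: "card V = 3 * k V" unfolding k_def using triples_card(2)[OF part[OF V] finV] .
    have w: "card (inside E V) = waste E V ?P + 3 * k V"
      using waste_triples[OF part[OF V] finV finE PV] k3 by simp
    have "pairs ?P \<inter> R = {}" using PV I(3) by blast
    hence rw: "card (inside R V) \<le> waste E V ?P"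
      using I(5)[OF component_closed[OF V]] triples_packing[OF part[OF V] component_subset[OF V]] by blast
    have kw: "4 * k V \<le> card (inside E V) + 1"
      unfolding k_def using component_card_edges[OF fin I(1) V part[OF V] PV] .
    show "7 * k V + card (inside R V) \<le> 2 * card (inside E V) + (if bad N E R V then 1 else 0)"
    proof (cases "card (inside E V) + 1 = 4 * k V \<and> card (inside R V) + 1 = k V")
      case True
      hence "bad N E R V" using V part[OF V] PV unfolding bad_def k_def by blast
      thus ?thesis using True by simp
    next
      case False
      hence "7 * k V + card (inside R V) \<le> 2 * card (inside E V)" using w rw kw by linarith
      thus ?thesis by simp
    qed
  qed
  have cover: "\<exists>V\<in>K. v \<in> V" if "v \<in> N" for v
    using component_exists[OF I(1) that] by (auto simp: K_def)
  have "card N \<le> card (\<Union>V\<in>K. V)"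
    using finK fin cover by (intro card_mono) (auto simp: K_def dest: component_subset intro: finite_subset)
  also have "\<dots> \<le> (\<Sum>V\<in>K. card V)" using finK by (rule card_UN_le)
  also have "\<dots> = 3 * (\<Sum>V\<in>K. k V)" using k3 by (simp add: sum_distrib_left)
  finally have N: "card N \<le> 3 * (\<Sum>V\<in>K. k V)" .
  have "R \<subseteq> (\<Union>V\<in>K. inside R V)"
  proof
    fix f assume f: "f \<in> R"
    hence "f \<subseteq> N" "card f = 2" using I(2) by (auto simp: nsets_def)
    moreover have "f \<noteq> {}" using calculation(2) by auto
    ultimately obtain v where v: "v \<in> f" "v \<in> N" by blast
    obtain V where "V \<in> K" "v \<in> V" using cover v by blast
    moreover have "f \<subseteq> V"
      using I(4)[OF component_closed f v(1) \<open>v \<in> V\<close>] \<open>V \<in> K\<close> by (simp add: K_def)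
    ultimately show "f \<in> (\<Union>V\<in>K. inside R V)" using f by (auto simp: inside_def)
  qed
  hence "card R \<le> card (\<Union>V\<in>K. inside R V)"
    using finK finR by (intro card_mono) (auto intro: finite_subset[OF inside_subset])
  also have "\<dots> \<le> (\<Sum>V\<in>K. card (inside R V))" using finK by (rule card_UN_le)
  finally have R: "card R \<le> (\<Sum>V\<in>K. card (inside R V))" .
  have "(\<Sum>V\<in>K. card (inside E V)) = card (\<Union>V\<in>K. inside E V)"
  proof (rule card_UN_disjoint[symmetric])
    show "\<forall>V\<in>K. \<forall>W\<in>K. V \<noteq> W \<longrightarrow> inside E V \<inter> inside E W = {}"
    proof (intro ballI impI, rule ccontr)
      fix V W assume "V \<in> K" "W \<in> K" "V \<noteq> W" "inside E V \<inter> inside E W \<noteq> {}"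
      then obtain g where g: "g \<in> E" "g \<subseteq> V" "g \<subseteq> W" by (auto simp: inside_def)
      hence "g \<noteq> {}" using I(1) by (auto simp: nsets_def)
      hence "V \<inter> W \<noteq> {}" using g by blast
      thus False using component_disjoint[of N E V W] \<open>V \<in> K\<close> \<open>W \<in> K\<close> \<open>V \<noteq> W\<close> by (simp add: K_def)
    qed
  qed (use finK finE finite_subset[OF inside_subset] in auto)
  also have "\<dots> \<le> card E" using finE by (intro card_mono) (auto simp: inside_def)
  finally have E: "(\<Sum>V\<in>K. card (inside E V)) \<le> card E" .
  have "(\<Sum>V\<in>K. if bad N E R V then 1 else 0) = card {V \<in> K. bad N E R V}"
    using finK by (simp add: sum.If_cases Int_def)
  also have "{V \<in> K. bad N E R V} = {V. bad N E R V}" by (auto simp: K_def bad_def)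
  finally have B: "(\<Sum>V\<in>K. if bad N E R V then 1 else 0) \<le> card R" using I(6) by simp
  \<comment> \<open>After summation the number of bad components on the right is at most
    \<open>card R\<close>, hence at most the registered edges counted on the left. The two cancel,
    leaving seven times the number of triangles at most \<open>2 * card E\<close>.\<close>
  have "7 * (\<Sum>V\<in>K. k V) + (\<Sum>V\<in>K. card (inside R V))
      \<le> 2 * (\<Sum>V\<in>K. card (inside E V)) + (\<Sum>V\<in>K. if bad N E R V then 1 else 0)"
    using sum_mono[OF loc] by (simp add: sum.distrib sum_distrib_left)
  thus ?thesis using N R E B by linarith
qed

section \<open>Client's strategy and the positions it reaches\<close>

fun delay_step :: "'a set \<Rightarrow> 'a set set \<times> 'a set set \<Rightarrow> 'a set set \<times> 'a set \<Rightarrow> 'a set set \<times> 'a set set" where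
  "delay_step N (E, R) (P, c) =
     (insert c E, if \<forall>e\<in>P. bad_move N E R e then R \<union> (P - {c}) else R)"

text \<open>A strategy sees only the history, so the register is recomputed by replaying it. The
  recomputation depends only on which offered edges were bad moves at the time and which one was
  taken.\<close>

definition delay_state :: "'a set \<Rightarrow> 'a set history \<Rightarrow> 'a set set \<times> 'a set set" where
  "delay_state N h = foldl (delay_step N) ({}, {}) h"

definition delay_strategy :: "'a set \<Rightarrow> 'a set client_strategy" where
  "delay_strategy N h P =
     (let (E, R) = delay_state N h in
      SOME c. c \<in> P \<and> (bad_move N E R c \<longrightarrow> (\<forall>e\<in>P. bad_move N E R e)))"

lemma delay_strategy:
  assumes "card P = 2" "delay_state N h = (E, R)"
  shows "delay_strategy N h P \<in> P"
    "bad_move N E R (delay_strategy N h P) \<longrightarrow> (\<forall>e\<in>P. bad_move N E R e)"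
proof -
  have "P \<noteq> {}" using assms by auto
  \<comment> \<open>Either some offered edge is not a bad move, or all are and any choice
    qualifies.\<close>
  hence "\<exists>c. c \<in> P \<and> (bad_move N E R c \<longrightarrow> (\<forall>e\<in>P. bad_move N E R e))" by blast
  from someI_ex[OF this]
  have "delay_strategy N h P \<in> P \<and>
      (bad_move N E R (delay_strategy N h P) \<longrightarrow> (\<forall>e\<in>P. bad_move N E R e))"
    unfolding delay_strategy_def assms(2) Let_def prod.case .
  thus "delay_strategy N h P \<in> P"
    "bad_move N E R (delay_strategy N h P) \<longrightarrow> (\<forall>e\<in>P. bad_move N E R e)"
    by blast+
qed

lemma delay_strategy_client: "delay_strategy N \<in> client_strategies"
  unfolding client_strategies_def using delay_strategy(1) surj_pair[of "delay_state N _"] by fastforce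

text \<open>The last conjunct says that taken and registered edges have all been offered before.
  This makes newly offered edges disjoint from \<open>E\<close> and \<open>R\<close>, as the
  preservation lemmas require.\<close>

lemma delay_state_play:
  assumes fin: "finite N" and \<sigma>: "\<sigma> \<in> waiter_strategies (nsets N 2)"
  defines "h \<equiv> play (nsets N 2) \<sigma> (delay_strategy N)"
  shows "\<exists>R. delay_state N (h k) = (client_elements (h k), R) \<and>
    delay_inv N (client_elements (h k)) R \<and> client_elements (h k) \<union> R \<subseteq> \<Union> (fst ` set (h k))"
proof (induction k)
  case 0
  show ?case
    using delay_inv_empty[OF fin] by (simp add: h_def delay_state_def client_elements_def)
next
  case (Suc k)
  define E where "E = client_elements (h k)"
  obtain R where st: "delay_state N (h k) = (E, R)" and inv: "delay_inv N E R"
    and sub: "E \<union> R \<subseteq> \<Union> (fst ` set (h k))"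
    using Suc by (auto simp: E_def)
  show ?case
  proof (cases "2 \<le> card (unclaimed (nsets N 2) (h k))")
    case False
    hence "h (Suc k) = h k" by (simp add: h_def)
    thus ?thesis using Suc by simp
  next
    case True
    define P where "P = \<sigma> (h k)"
    define c where "c = delay_strategy N (h k) P"
    have hS: "h (Suc k) = h k @ [(P, c)]" using True by (simp add: h_def P_def c_def Let_def)
    have P: "P \<subseteq> unclaimed (nsets N 2) (h k)" "card P = 2"
      using \<sigma> True by (auto simp: waiter_strategies_def P_def)
    have new: "e \<in> nsets N 2" "e \<notin> E" "e \<notin> R" if "e \<in> P" for e
      using P(1) sub that by (auto simp: unclaimed_def)
    have c: "c \<in> P" "bad_move N E R c \<longrightarrow> (\<forall>e\<in>P. bad_move N E R e)"
      using delay_strategy[OF P(2) st] by (simp_all add: c_def)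
    have "card (P - {c}) = 1" using P(2) c(1) by simp
    then obtain f where f: "P - {c} = {f}" by (auto simp: card_1_singleton_iff)
    hence fP: "f \<in> P" "c \<noteq> f" by auto
    define R' where "R' = (if \<forall>e\<in>P. bad_move N E R e then insert f R else R)"
    have CE: "client_elements (h (Suc k)) = insert c E"
      by (simp add: hS client_elements_def E_def)
    have "delay_state N (h (Suc k)) = delay_step N (E, R) (P, c)"
      using st by (simp add: hS delay_state_def)
    hence "delay_state N (h (Suc k)) = (insert c E, R')"
      using f by (simp add: R'_def)
    moreover have "delay_inv N (insert c E) R'"
    proof (cases "\<forall>e\<in>P. bad_move N E R e")
      case True
      hence "bad_move N E R f" using fP by blast
      thus ?thesis
        using True delay_inv_register[OF fin inv new(1,3)[OF c(1)] new[OF fP(1)] fP(2)] by (simp add: R'_def)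
    next
      case False
      thus ?thesis
        using delay_inv_take[OF fin inv new(1,3)[OF c(1)]] c(2) unfolding R'_def by auto
    qed
    moreover have "insert c E \<union> R' \<subseteq> \<Union> (fst ` set (h (Suc k)))"
      using sub c(1) fP(1) by (auto simp: hS R'_def)
    ultimately show ?thesis using CE by auto
  qed
qed

section \<open>From edge counts to numbers of rounds\<close>

lemma length_play: "length (play X \<sigma> \<rho> k) \<le> k"
  by (induction k) (auto simp: Let_def)

lemma won_after_delay_strategy:
  assumes "\<sigma> \<in> waiter_strategies (K_edges n)"
    and "won_after (K_edges n) (triangle_factors n) \<sigma> (delay_strategy {..<n}) k"
  shows "7 * n \<le> 6 * k"
proof -
  define h where "h = play (K_edges n) \<sigma> (delay_strategy {..<n}) k"
  obtain R where inv: "delay_inv {..<n} (client_elements h) R"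
    using delay_state_play[of "{..<n}" \<sigma> k] assms(1) unfolding h_def K_edges_def by auto
  obtain P where "triples {..<n} P" "pairs P \<subseteq> client_elements h"
    using assms(2) by (auto simp: won_after_def triangle_factors_def triples_def pairs_def h_def)
  hence "7 * n \<le> 6 * card (client_elements h)"
    using delay_inv_factor_card[OF _ inv] by simp
  also have "card (client_elements h) \<le> length h"
    unfolding client_elements_def using card_image_le[of "set h" snd] card_length[of h] by simp
  also have "length h \<le> k" unfolding h_def by (rule length_play)
  finally show ?thesis by simp
qed

theorem theorem1p2:
  fixes n :: nat
  assumes "3 dvd n"
    and "waiter_has_winning_strategy (K_edges n) (triangle_factors n)"
  shows "ereal_of_enat (tau_WC (K_edges n) (triangle_factors n)) \<ge> ereal (7 / 6 * real n)"
proof -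
  \<comment> \<open>This is \<open>7n/6\<close> rounded up: the game value is an
    \<open>enat\<close>, so the bound is first proved for an integer.\<close>
  define m where "m = (7 * n + 5) div 6"
  have "enat m \<le> rounds (K_edges n) (triangle_factors n) \<sigma> (delay_strategy {..<n})"
    if "\<sigma> \<in> waiter_strategies (K_edges n)" for \<sigma>
    unfolding rounds_def
  proof (rule INF_greatest)
    fix k assume "k \<in> {k. won_after (K_edges n) (triangle_factors n) \<sigma> (delay_strategy {..<n}) k}"
    hence "7 * n \<le> 6 * k" using won_after_delay_strategy[OF that] by simp
    thus "enat m \<le> enat k" by (simp add: m_def)
  qed
  \<comment> \<open>Against each Waiter strategy, the delaying strategy alone bounds the supremum
    over Client strategies from below; plays that Waiter never wins count as infinite.\<close>
  hence "enat m \<le> tau_WC (K_edges n) (triangle_factors n)"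
    unfolding tau_WC_def
    by (intro INF_greatest) (metis SUP_upper delay_strategy_client order.trans)
  hence "ereal_of_enat (enat m) \<le> ereal_of_enat (tau_WC (K_edges n) (triangle_factors n))"
    by (simp only: ereal_of_enat_le_iff)
  moreover have "7 * n \<le> 6 * m" by (simp add: m_def)
  hence "7 * real n \<le> 6 * real m" by (metis of_nat_le_iff of_nat_mult of_nat_numeral)
  hence "ereal (7 / 6 * real n) \<le> ereal_of_enat (enat m)" by simp
  ultimately show ?thesis by (rule order.trans[rotated])
qed

end
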